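(* Let $k\ge 1$ be an integer, let $(M,J)=(M_k,J_k)$ be the complex manifold described in the context, let $0<\varepsilon<1/10$, and let $H=(\{0\}\times\overline{\Delta})\cup([-1,1]\times\mathbb{S}^1)\subset\mathbb{C}^2$. Define $f:H\to M$ by $$f(0,\eta)=(0,(1-\varepsilon)\eta)\ \text{ for } \eta\in\overline{\Delta},\qquad f(\zeta,e^{i\theta})=(\zeta,(1-\varepsilon)e^{i\theta})\ \text{ for } \zeta\in[-1,1],\ \theta\in\mathbb{R}.$$ Then there is no open neighborhood of $f(H)$ in $(M,J)$ which is biholomorphic to an open set in some Stein manifold.
   Context: $\Delta$ is the open unit disk in $\mathbb{C}$ and $\mathbb{S}^1$ is the unit circle. Fix a function $\lambda\in C^\infty(\mathbb{R})$ with $0\le\lambda\le1$, $\lambda(t)=0$ for $t<1/9$ and $\lambda(t)=1$ for $t>4/9$. For an integer $k\ge1$ let $$M=M_k:=(\mathbb{C}\times\Delta)\setminus\Big(\{(z,w):\tfrac13\le|z|\le\tfrac23,\ w^2=z^k\lambda(|z|^2)\}\cup\{(z,w):|z|\ge\tfrac13,\ w=0\}\Big).$$ Define $a_k$ on $M$ by $$a_k(z,w)=\frac{w\,z^{k+1}\lambda'(|z|^2)}{w^2-z^k\lambda(|z|^2)}\ \text{ for } \tfrac13<|z|<\tfrac23,\qquad a_k(z,w)=0\ \text{ otherwise}.$$ $J=J_k$ is the (integrable) almost complex structure on $M$ whose $(1,0)$-forms are spanned, over smooth functions, by $dz$ and $dw+a_k\,d\bar z$; $(M,J)$ is a complex manifold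 of complex dimension two, and "biholomorphic" refers to the structure $J$. *)

theory Defs
  imports "HOL-Analysis.Analysis"
begin

section \<open>Holomorphic maps between almost complex domains\<close>

text \<open>
  An almost complex structure on a domain of a real vector space \<open>'v\<close> is given by its
  \<open>(1,0)\<close>-forms: \<open>T p\<close> is the set of covectors of type \<open>(1,0)\<close> at \<open>p\<close>, as functions
  \<open>'v \<Rightarrow> complex\<close>. A map is holomorphic if it is continuously differentiable and pulls back
  \<open>(1,0)\<close>-forms to \<open>(1,0)\<close>-forms, that is, if its differential intertwines the two
  structures. It is meant for open \<open>S\<close>. Demanding only \<open>C\<^sup>1\<close> is no restriction: for
  integrable structures such maps are automatically smooth.
\<close>

type_synonym 'v forms10 = "'v \<Rightarrow> ('v \<Rightarrow> complex) set"

definition holo_on ::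
    "'v::real_normed_vector forms10 \<Rightarrow> 'u::real_normed_vector forms10 \<Rightarrow> 'v set \<Rightarrow> ('v \<Rightarrow> 'u) \<Rightarrow> bool"
  where
  "holo_on T T' S G \<longleftrightarrow>
     (\<exists>D :: 'v \<Rightarrow> 'v \<Rightarrow>\<^sub>L 'u. continuous_on S D \<and>
        (\<forall>p\<in>S. (G has_derivative blinfun_apply (D p)) (at p) \<and>
               (\<forall>\<alpha>\<in>T' (G p). \<alpha> \<circ> blinfun_apply (D p) \<in> T p)))"

text \<open>The standard structures: the span of \<open>dz\<close>, respectively of \<open>dz\<^sub>1, \<dots>, dz\<^sub>n\<close>.\<close>

definition forms_C :: "complex forms10" where
  "forms_C p = {\<lambda>v. c * v | c. True}"

definition forms_Cn :: "(complex ^ 'n::finite) forms10" where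
  "forms_Cn p = {\<lambda>v. \<Sum>i\<in>UNIV. c $ i * v $ i | c. True}"


section \<open>Complex manifolds and Stein manifolds\<close>

text \<open>
  A complex manifold of dimension \<open>CARD('n)\<close> is a topology with an atlas of charts
  \<open>(W, \<phi>)\<close>; the values of \<open>\<phi>\<close> outside \<open>W\<close> are irrelevant.
\<close>

type_synonym ('a, 'n) atlas = "('a set \<times> ('a \<Rightarrow> complex ^ 'n)) set"

definition complex_manifold :: "'a topology \<Rightarrow> ('a, 'n::finite) atlas \<Rightarrow> bool" where
  "complex_manifold X A \<longleftrightarrow>
     Hausdorff_space X \<and> second_countable X \<and>
     (\<Union>(W, \<phi>)\<in>A. W) = topspace X \<and>
     (\<forall>(W, \<phi>)\<in>A. openin X W \<and> open (\<phi> ` W) \<and>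
        homeomorphic_map (subtopology X W) (top_of_set (\<phi> ` W)) \<phi>) \<and>
     (\<forall>(W, \<phi>)\<in>A. \<forall>(W', \<psi>)\<in>A.
        holo_on forms_Cn forms_Cn (\<phi> ` (W \<inter> W')) (\<psi> \<circ> inv_into W \<phi>))"

definition holo_functions :: "('a, 'n::finite) atlas \<Rightarrow> ('a \<Rightarrow> complex) set" where
  "holo_functions A =
     {h. \<forall>(W, \<phi>)\<in>A. holo_on forms_Cn forms_C (\<phi> ` W) (h \<circ> inv_into W \<phi>)}"

definition holo_hull :: "'a topology \<Rightarrow> ('a, 'n::finite) atlas \<Rightarrow> 'a set \<Rightarrow> 'a set" where
  "holo_hull X A K =
     {x \<in> topspace X. \<forall>h\<in>holo_functions A. cmod (h x) \<le> (SUP y\<in>K. cmod (h y))}"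

text \<open>
  The empty compact set is excluded below because the supremum over it is unspecified
  for reals.
\<close>

definition stein_manifold :: "'a topology \<Rightarrow> ('a, 'n::finite) atlas \<Rightarrow> bool" where
  "stein_manifold X A \<longleftrightarrow>
     complex_manifold X A \<and>
     (\<forall>K. compactin X K \<and> K \<noteq> {} \<longrightarrow> compactin X (holo_hull X A K)) \<and>
     (\<forall>x\<in>topspace X. \<forall>y\<in>topspace X. x \<noteq> y \<longrightarrow> (\<exists>h\<in>holo_functions A. h x \<noteq> h y))"

text \<open>
  Biholomorphisms from an open subset \<open>U\<close> of a vector space with almost complex structure
  \<open>T\<close> onto an open subset \<open>V\<close> of a complex manifold.
\<close>

definition biholomorphism ::
    "'v::real_normed_vector forms10 \<Rightarrow> 'v set \<Rightarrow> 'a topology \<Rightarrow> ('a, 'n::finite) atlas \<Rightarrow> 'a set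
      \<Rightarrow> ('v \<Rightarrow> 'a) \<Rightarrow> ('a \<Rightarrow> 'v) \<Rightarrow> bool"
  where
  "biholomorphism T U X A V F G \<longleftrightarrow>
     homeomorphic_maps (top_of_set U) (subtopology X V) F G \<and>
     (\<forall>(W, \<phi>)\<in>A. holo_on T forms_Cn {p \<in> U. F p \<in> W} (\<phi> \<circ> F) \<and>
                  holo_on forms_Cn T (\<phi> ` (V \<inter> W)) (G \<circ> inv_into W \<phi>))"

definition biholomorphic_to_open_subset ::
    "'v::real_normed_vector forms10 \<Rightarrow> 'v set \<Rightarrow> 'a topology \<Rightarrow> ('a, 'n::finite) atlas \<Rightarrow> bool"
  where
  "biholomorphic_to_open_subset T U X A \<longleftrightarrow>
     (\<exists>V F G. openin X V \<and> biholomorphism T U X A V F G)"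


section \<open>The manifold and the Hartogs figure\<close>

definition smooth_real :: "(real \<Rightarrow> real) \<Rightarrow> bool" where
  "smooth_real f \<longleftrightarrow> (\<forall>n t. (deriv ^^ n) f field_differentiable (at t))"

definition cutoff :: "(real \<Rightarrow> real) \<Rightarrow> bool" where
  "cutoff lam \<longleftrightarrow> smooth_real lam \<and> (\<forall>t. 0 \<le> lam t \<and> lam t \<le> 1) \<and>
     (\<forall>t<1/9. lam t = 0) \<and> (\<forall>t>4/9. lam t = 1)"

definition M_set :: "(real \<Rightarrow> real) \<Rightarrow> nat \<Rightarrow> (complex \<times> complex) set" where
  "M_set lam k = (UNIV \<times> ball 0 1) -
     ({(z, w). 1/3 \<le> cmod z \<and> cmod z \<le> 2/3 \<and> w\<^sup>2 = z ^ k * of_real (lam ((cmod z)\<^sup>2))} \<union>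
      {(z, w). 1/3 \<le> cmod z \<and> w = 0})"

definition a_coeff :: "(real \<Rightarrow> real) \<Rightarrow> nat \<Rightarrow> complex \<times> complex \<Rightarrow> complex" where
  "a_coeff lam k = (\<lambda>(z, w).
     if 1/3 < cmod z \<and> cmod z < 2/3
     then w * z ^ (k + 1) * of_real (deriv lam ((cmod z)\<^sup>2)) /
            (w\<^sup>2 - z ^ k * of_real (lam ((cmod z)\<^sup>2)))
     else 0)"

text \<open>The structure whose \<open>(1,0)\<close>-forms are spanned by \<open>dz\<close> and \<open>dw + a d\<bar>z\<close>.\<close>

definition J_forms :: "(real \<Rightarrow> real) \<Rightarrow> nat \<Rightarrow> (complex \<times> complex) forms10" where
  "J_forms lam k p =
     {\<lambda>(\<zeta>, \<eta>). c * \<zeta> + d * (\<eta> + a_coeff lam k p * cnj \<zeta>) | c d. True}"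

definition hartogs_H :: "(complex \<times> complex) set" where
  "hartogs_H = ({0} \<times> cball 0 1) \<union> (complex_of_real ` {-1..1} \<times> sphere 0 1)"

text \<open>One formula covers both parts of the figure.\<close>

definition hartogs_f :: "real \<Rightarrow> complex \<times> complex \<Rightarrow> complex \<times> complex" where
  "hartogs_f \<epsilon> = (\<lambda>(\<zeta>, \<eta>). (\<zeta>, of_real (1 - \<epsilon>) * \<eta>))"

text \<open>
  Sanity checks: the set is open in \<open>\<complex>\<^sup>2\<close>, and the figure is mapped into it.
\<close>

lemma open_M_set:
  assumes "cutoff lam"
  shows "open (M_set lam k)"
proof -
  have cont: "continuous_on UNIV lam"
  proof -
    have "lam field_differentiable (at t)" for t
      using assms unfolding cutoff_def smooth_real_def by (metis funpow_0)
    then show ?thesis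
      by (simp add: continuous_on_eq_continuous_at field_differentiable_imp_continuous_at)
  qed
  have cont': "continuous_on UNIV (\<lambda>p :: complex \<times> complex. lam ((cmod (fst p))\<^sup>2))"
    by (rule continuous_on_compose2[OF cont]) (auto intro!: continuous_intros)
  have "closed {p :: complex \<times> complex. 1/3 \<le> cmod (fst p) \<and> cmod (fst p) \<le> 2/3 \<and>
                 (snd p)\<^sup>2 = fst p ^ k * of_real (lam ((cmod (fst p))\<^sup>2))}"
    by (intro closed_Collect_conj closed_Collect_le closed_Collect_eq continuous_intros cont')
  moreover have "closed {p :: complex \<times> complex. 1/3 \<le> cmod (fst p) \<and> snd p = 0}"
    by (intro closed_Collect_conj closed_Collect_le closed_Collect_eq continuous_intros)
  ultimately show ?thesis
    unfolding M_set_def case_prod_beta by (intro open_Diff open_Times closed_Un) auto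
qed

lemma hartogs_f_image_subset:
  assumes lam: "cutoff lam" and eps: "0 < \<epsilon>" "\<epsilon> < 1/10" and k: "1 \<le> k"
  shows "hartogs_f \<epsilon> ` hartogs_H \<subseteq> M_set lam k"
proof
  fix p assume "p \<in> hartogs_f \<epsilon> ` hartogs_H"
  then obtain z \<eta> where p: "p = (z, of_real (1 - \<epsilon>) * \<eta>)" and H: "(z, \<eta>) \<in> hartogs_H"
    by (auto simp: hartogs_f_def)
  define w where "w = of_real (1 - \<epsilon>) * \<eta>"
  have w: "cmod w = (1 - \<epsilon>) * cmod \<eta>"
    unfolding w_def norm_mult norm_of_real using eps by simp
  have \<eta>: "cmod \<eta> \<le> 1" "z = 0 \<or> cmod \<eta> = 1"
    using H by (auto simp: hartogs_H_def)
  have "cmod w \<le> 1 - \<epsilon>"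
    unfolding w using eps \<eta>(1) by (intro mult_left_le) auto
  then have w1: "cmod w < 1" using eps by simp
  have False if z: "1/3 \<le> cmod z" and w2: "w = 0"
    using w \<eta>(2) eps z w2 by auto
  moreover have False
    if z: "1/3 \<le> cmod z" "cmod z \<le> 2/3" and eq: "w\<^sup>2 = z ^ k * of_real (lam ((cmod z)\<^sup>2))"
  proof -
    have "cmod \<eta> = 1" using \<eta>(2) z by auto
    then have "(1 - \<epsilon>)\<^sup>2 = cmod (w\<^sup>2)" by (simp add: norm_power w)
    also have "\<dots> = cmod z ^ k * \<bar>lam ((cmod z)\<^sup>2)\<bar>"
      by (simp add: eq norm_mult norm_power)
    also have "\<dots> \<le> cmod z ^ k * 1"
      using lam by (intro mult_left_mono) (auto simp: cutoff_def)
    also have "\<dots> \<le> cmod z"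
      using power_decreasing[OF k, of "cmod z"] z by simp
    finally have "(1 - \<epsilon>)\<^sup>2 \<le> 2/3" using z by simp
    moreover have "(9/10)\<^sup>2 \<le> (1 - \<epsilon>)\<^sup>2" using eps by (intro power_mono) auto
    ultimately show False by (simp add: power2_eq_square)
  qed
  ultimately show "p \<in> M_set lam k"
    using w1 unfolding p w_def[symmetric] M_set_def by auto
qed

end

theory Submission
  imports Defs "HOL-Complex_Analysis.Complex_Analysis"
begin

text \<open>
  Put \<open>v(z) = z\<^sup>k \<lambda>(|z|\<^sup>2)\<close>. The function \<open>u = w + v/w\<close> is holomorphic for \<open>J\<close>, so for
  every holomorphic \<open>g\<close> near the figure the moments \<open>\<oint> g u\<^sup>n du\<close> over the circles \<open>|w| = 1 - \<epsilon>\<close>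
  depend holomorphically on \<open>z\<close>. Near \<open>z = 0\<close> they vanish by Cauchy's theorem, hence they vanish
  along \<open>[0, 1]\<close>. At the point with \<open>z\<^sup>k = (1 - \<epsilon>)\<^sup>2\<close> the map \<open>u\<close> folds the circle onto a segment,
  identifying \<open>w\<close> with its conjugate, and the vanishing of all moments forces \<open>g\<close> to take the same
  value at \<open>w\<close> and at its conjugate. So the holomorphic functions of the neighbourhood do not
  separate its points, although those of a Stein manifold would.
\<close>

section \<open>Composition, gluing and pullback of holomorphic maps\<close>

lemma holo_on_comp:
  assumes G: "holo_on T T' S G" and H: "holo_on T' T'' S' H" and sub: "G ` S \<subseteq> S'"
  shows "holo_on T T'' S (H \<circ> G)"
proof -
  obtain D where D: "continuous_on S D"
    "\<And>p. p \<in> S \<Longrightarrow> (G has_derivative blinfun_apply (D p)) (at p)"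
    "\<And>p \<alpha>. p \<in> S \<Longrightarrow> \<alpha> \<in> T' (G p) \<Longrightarrow> \<alpha> \<circ> blinfun_apply (D p) \<in> T p"
    using G unfolding holo_on_def by metis
  obtain E where E: "continuous_on S' E"
    "\<And>p. p \<in> S' \<Longrightarrow> (H has_derivative blinfun_apply (E p)) (at p)"
    "\<And>p \<alpha>. p \<in> S' \<Longrightarrow> \<alpha> \<in> T'' (H p) \<Longrightarrow> \<alpha> \<circ> blinfun_apply (E p) \<in> T' p"
    using H unfolding holo_on_def by metis
  have contG: "continuous_on S G"
    using D(2) by (meson continuous_at_imp_continuous_on has_derivative_continuous)
  show ?thesis
    unfolding holo_on_def
  proof (intro exI[of _ "\<lambda>p. E (G p) o\<^sub>L D p"] conjI ballI)
    show "continuous_on S (\<lambda>p. E (G p) o\<^sub>L D p)"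
      by (intro continuous_intros D(1) continuous_on_compose2[OF E(1) contG sub])
    fix p assume p: "p \<in> S"
    then have Gp: "G p \<in> S'" using sub by auto
    show "((H \<circ> G) has_derivative blinfun_apply (E (G p) o\<^sub>L D p)) (at p)"
      using diff_chain_at[OF D(2)[OF p] E(2)[OF Gp]]
      by (simp add: blinfun_compose.rep_eq comp_def)
    fix \<alpha> assume "\<alpha> \<in> T'' ((H \<circ> G) p)"
    then have "(\<alpha> \<circ> blinfun_apply (E (G p))) \<circ> blinfun_apply (D p) \<in> T p"
      using D(3)[OF p] E(3)[OF Gp] by auto
    then show "\<alpha> \<circ> blinfun_apply (E (G p) o\<^sub>L D p) \<in> T p"
      by (simp add: blinfun_compose.rep_eq comp_assoc)
  qed
qed

lemma holo_on_cong:
  assumes "holo_on T T' S G" "open S" "\<And>p. p \<in> S \<Longrightarrow> G p = H p"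
  shows "holo_on T T' S H"
proof -
  obtain D where D: "continuous_on S D"
    "\<And>p. p \<in> S \<Longrightarrow> (G has_derivative blinfun_apply (D p)) (at p) \<and>
               (\<forall>\<alpha>\<in>T' (G p). \<alpha> \<circ> blinfun_apply (D p) \<in> T p)"
    using assms(1) unfolding holo_on_def by metis
  have "(H has_derivative blinfun_apply (D p)) (at p)" if "p \<in> S" for p
    using has_derivative_transform_within_open[of G _ p UNIV S H] D(2)[OF that] assms(2,3) that
    by auto
  then show ?thesis
    unfolding holo_on_def using D assms(3) by (intro exI[of _ D]) auto
qed

text \<open>The derivative at a point is unique, so \<open>frechet_derivative\<close> agrees with
  every local witness. Continuity is local on open sets, hence one global \<open>D\<close> serves
  the whole family.\<close>

lemma holo_on_Union:
  assumes op: "\<And>S. S \<in> \<S> \<Longrightarrow> open S" and holo: "\<And>S. S \<in> \<S> \<Longrightarrow> holo_on T T' S G"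
  shows "holo_on T T' (\<Union>\<S>) G"
proof -
  define D where "D p = Blinfun (frechet_derivative G (at p))" for p
  have loc: "continuous_on S D \<and> (\<forall>p\<in>S. (G has_derivative blinfun_apply (D p)) (at p) \<and>
               (\<forall>\<alpha>\<in>T' (G p). \<alpha> \<circ> blinfun_apply (D p) \<in> T p))" if S: "S \<in> \<S>" for S
  proof -
    obtain E where E: "continuous_on S E"
      "\<And>p. p \<in> S \<Longrightarrow> (G has_derivative blinfun_apply (E p)) (at p) \<and>
                 (\<forall>\<alpha>\<in>T' (G p). \<alpha> \<circ> blinfun_apply (E p) \<in> T p)"
      using holo[OF S] unfolding holo_on_def by metis
    have "D p = E p" if "p \<in> S" for p
      using E(2)[OF that] frechet_derivative_at[of G _ p]
      by (metis D_def blinfun_apply_inverse)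
    then show ?thesis
      using E by (simp cong: continuous_on_cong)
  qed
  have "continuous_on (\<Union>\<S>) D"
    using continuous_on_open_Union[OF op, of \<S> D] loc by auto
  then show ?thesis
    unfolding holo_on_def using loc by (intro exI[of _ D]) auto
qed

text \<open>On the preimage of a chart domain \<open>W\<close> the map \<open>h \<circ> F\<close>
  factors as \<open>(h \<circ> inv_into W \<phi>) \<circ> (\<phi> \<circ> F)\<close>, and these open
  preimages cover \<open>U\<close>.\<close>

lemma holo_functions_comp_biholomorphism:
  assumes h: "h \<in> holo_functions A" and X: "complex_manifold X A" and U: "open U"
    and bih: "biholomorphism T U X A V F G"
  shows "holo_on T forms_C U (h \<circ> F)"
proof -
  have F: "continuous_map (top_of_set U) (subtopology X V) F"
    using bih by (simp add: biholomorphism_def homeomorphic_maps_def)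
  then have FX: "continuous_map (top_of_set U) X F"
    using continuous_map_into_fulltopology by blast
  define S where "S W = {p \<in> U. F p \<in> W}" for W
  have cover: "(\<Union>(W, \<phi>)\<in>A. W) = topspace X"
    using X by (simp add: complex_manifold_def)
  have chart: "openin X W" "inj_on \<phi> W" if "(W, \<phi>) \<in> A" for W \<phi>
  proof -
    have *: "openin X W" "homeomorphic_map (subtopology X W) (top_of_set (\<phi> ` W)) \<phi>"
      using X that unfolding complex_manifold_def by blast+
    then show "openin X W" "inj_on \<phi> W"
      using homeomorphic_imp_injective_map[OF *(2)] openin_subset[OF *(1)]
      by (auto simp: Int_absorb1)
  qed
  have opS: "open (S W)" if "(W, \<phi>) \<in> A" for W \<phi>
    using openin_continuous_map_preimage[OF FX chart(1)[OF that]] U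
    by (simp add: S_def openin_open_eq)
  have "holo_on T forms_C (S W) (h \<circ> F)" if W: "(W, \<phi>) \<in> A" for W \<phi>
  proof (rule holo_on_cong)
    have "holo_on T forms_Cn (S W) (\<phi> \<circ> F)"
      using bih W unfolding biholomorphism_def S_def by blast
    moreover have "holo_on forms_Cn forms_C (\<phi> ` W) (h \<circ> inv_into W \<phi>)"
      using h W unfolding holo_functions_def by blast
    ultimately show "holo_on T forms_C (S W) ((h \<circ> inv_into W \<phi>) \<circ> (\<phi> \<circ> F))"
      by (rule holo_on_comp) (auto simp: S_def)
  qed (use opS[OF W] chart(2)[OF W] in \<open>auto simp: S_def\<close>)
  then have "holo_on T forms_C (\<Union>(S ` fst ` A)) (h \<circ> F)"
    by (intro holo_on_Union) (auto intro: opS)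
  moreover have "\<Union>(S ` fst ` A) = U"
  proof
    show "U \<subseteq> \<Union>(S ` fst ` A)"
    proof
      fix p assume p: "p \<in> U"
      then have "F p \<in> topspace X"
        using continuous_map_image_subset_topspace[OF FX] by auto
      then obtain W \<phi> where "(W, \<phi>) \<in> A" "F p \<in> W"
        unfolding cover[symmetric] by (auto split: prod.splits)
      then show "p \<in> \<Union>(S ` fst ` A)" using p by (force simp: S_def)
    qed
  qed (auto simp: S_def)
  ultimately show ?thesis by simp
qed

section \<open>The Cauchy-Riemann equations of \<open>J\<close>\<close>

text \<open>The pullback of \<open>dz\<close> under \<open>g\<close> is \<open>dg\<close>, which
  therefore lies in the span of \<open>dz\<close> and \<open>dw + a dzbar\<close>. Comparing
  coefficients removes the part antilinear in \<eta> and ties the \<open>dzbar\<close> coefficient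
  to the \<open>dw\<close> coefficient.\<close>

lemma J_holomorphic_wirtinger:
  assumes "holo_on (J_forms lam k) forms_C U g"
  obtains gz gzb gw :: "complex \<times> complex \<Rightarrow> complex"
  where "continuous_on U gz" "continuous_on U gzb" "continuous_on U gw"
    "\<And>p. p \<in> U \<Longrightarrow> (g has_derivative (\<lambda>(\<zeta>, \<eta>). gz p * \<zeta> + gzb p * cnj \<zeta> + gw p * \<eta>)) (at p)"
    "\<And>p. p \<in> U \<Longrightarrow> gzb p = gw p * a_coeff lam k p"
proof -
  obtain D where D: "continuous_on U D"
    "\<And>p. p \<in> U \<Longrightarrow> (g has_derivative blinfun_apply (D p)) (at p)"
    "\<And>p \<alpha>. p \<in> U \<Longrightarrow> \<alpha> \<in> forms_C (g p) \<Longrightarrow> \<alpha> \<circ> blinfun_apply (D p) \<in> J_forms lam k p"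
    using assms unfolding holo_on_def by metis
  \<comment> \<open>The values of the differential at 1 and \<i> determine its linear and antilinear
    parts in z. Expressed through \<open>D\<close>, the coefficients inherit continuity.\<close>
  let ?gz = "\<lambda>p. (D p (1, 0) - \<i> * D p (\<i>, 0)) / 2"
  let ?gzb = "\<lambda>p. (D p (1, 0) + \<i> * D p (\<i>, 0)) / 2"
  let ?gw = "\<lambda>p. D p (0, 1)"
  have J: "blinfun_apply (D p) = (\<lambda>(\<zeta>, \<eta>). ?gz p * \<zeta> + ?gzb p * cnj \<zeta> + ?gw p * \<eta>) \<and>
      ?gzb p = ?gw p * a_coeff lam k p" if p: "p \<in> U" for p
  proof -
    have "(\<lambda>v. 1 * v) \<in> forms_C (g p)" unfolding forms_C_def by blast
    then have "(\<lambda>v. 1 * v) \<circ> blinfun_apply (D p) \<in> J_forms lam k p"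
      by (rule D(3)[OF p])
    then obtain c d where cd:
      "blinfun_apply (D p) = (\<lambda>(\<zeta>, \<eta>). c * \<zeta> + d * (\<eta> + a_coeff lam k p * cnj \<zeta>))"
      unfolding J_forms_def by (auto simp: comp_def)
    show ?thesis
      unfolding cd by (auto simp: fun_eq_iff algebra_simps)
  qed
  show ?thesis
  proof (rule that[of ?gz ?gzb ?gw])
    show "(g has_derivative (\<lambda>(\<zeta>, \<eta>). ?gz p * \<zeta> + ?gzb p * cnj \<zeta> + ?gw p * \<eta>)) (at p)"
      if "p \<in> U" for p
      using D(2)[OF that] J[OF that] by metis
    show "?gzb p = ?gw p * a_coeff lam k p" if "p \<in> U" for p
      using J[OF that] by blast
  qed (auto intro!: continuous_intros D(1))
qed

section \<open>Functions on a half circle with vanishing moments\<close>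

text \<open>Under s = cos t the hypothesis becomes orthogonality of \<open>\<phi> (arccos s)\<close>
  to all polynomials on [-1, 1]. These approximate it uniformly by Weierstrass, so its weighted
  square has integral zero.\<close>

lemma real_cos_moments_zero:
  fixes \<phi> :: "real \<Rightarrow> real"
  assumes cont: "continuous_on {0..pi} \<phi>"
    and mom: "\<And>n. integral {0..pi} (\<lambda>t. \<phi> t * cos t ^ n * sin t) = 0"
    and t: "0 < t" "t < pi"
  shows "\<phi> t = 0"
proof -
  have int: "f integrable_on {0..pi}" if "continuous_on {0..pi} f" for f :: "real \<Rightarrow> real"
    using integrable_continuous_interval[OF that] .
  have cq: "continuous_on {-1..1} (\<lambda>s. \<phi> (arccos s))"
    by (rule continuous_on_compose2[OF cont continuous_on_arccos'])
      (auto simp: arccos_lbound arccos_ubound)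
  define L where "L = integral {0..pi} (\<lambda>t. \<bar>\<phi> t\<bar> * sin t)"
  have L0: "0 \<le> L"
    unfolding L_def by (rule integral_nonneg)
      (auto intro!: int continuous_intros cont mult_nonneg_nonneg sin_ge_zero)
  \<comment> \<open>Since \<phi> is orthogonal to p(cos t), its square may be replaced under the
    integral by \<phi> (\<phi> - p(cos t)), which is at most e |\<phi>|.\<close>
  have le: "integral {0..pi} (\<lambda>t. (\<phi> t)\<^sup>2 * sin t) \<le> e * L" if e: "0 < e" for e
  proof -
    obtain p where p: "real_polynomial_function p"
      "\<And>s. s \<in> {-1..1} \<Longrightarrow> \<bar>\<phi> (arccos s) - p s\<bar> < e"
      using Stone_Weierstrass_real_polynomial_function[OF compact_Icc cq e] by blast
    obtain c n where pc: "p = (\<lambda>s. \<Sum>i\<le>n. c i * s ^ i)"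
      using p(1) real_polynomial_function_imp_sum by blast
    have close: "\<bar>\<phi> t - p (cos t)\<bar> < e" if "t \<in> {0..pi}" for t
      using p(2)[of "cos t"] that by (simp add: arccos_cos)
    have cp: "continuous_on {0..pi} (\<lambda>t. p (cos t))"
      unfolding pc by (intro continuous_intros)
    have "integral {0..pi} (\<lambda>t. \<phi> t * p (cos t) * sin t) =
        integral {0..pi} (\<lambda>t. \<Sum>i\<le>n. c i * (\<phi> t * cos t ^ i * sin t))"
      unfolding pc by (simp add: sum_distrib_left sum_distrib_right mult_ac)
    also have "\<dots> = (\<Sum>i\<le>n. integral {0..pi} (\<lambda>t. c i * (\<phi> t * cos t ^ i * sin t)))"
      by (rule integral_sum) (auto intro!: int continuous_intros cont)
    also have "\<dots> = 0" by (simp add: mom)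
    finally have orth: "integral {0..pi} (\<lambda>t. \<phi> t * p (cos t) * sin t) = 0" .
    have "integral {0..pi} (\<lambda>t. (\<phi> t)\<^sup>2 * sin t) =
        integral {0..pi} (\<lambda>t. (\<phi> t)\<^sup>2 * sin t) - integral {0..pi} (\<lambda>t. \<phi> t * p (cos t) * sin t)"
      by (simp add: orth)
    also have "\<dots> = integral {0..pi} (\<lambda>t. (\<phi> t)\<^sup>2 * sin t - \<phi> t * p (cos t) * sin t)"
      by (rule integral_diff[symmetric]) (auto intro!: int continuous_intros cont cp)
    also have "\<dots> \<le> integral {0..pi} (\<lambda>t. e * (\<bar>\<phi> t\<bar> * sin t))"
    proof (rule integral_le)
      fix t assume t: "t \<in> {0..pi}"
      have "(\<phi> t)\<^sup>2 * sin t - \<phi> t * p (cos t) * sin t = (\<phi> t * (\<phi> t - p (cos t))) * sin t"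
        by (simp add: power2_eq_square algebra_simps)
      also have "\<dots> \<le> (\<bar>\<phi> t\<bar> * e) * sin t"
      proof (rule mult_right_mono)
        have "\<phi> t * (\<phi> t - p (cos t)) \<le> \<bar>\<phi> t\<bar> * \<bar>\<phi> t - p (cos t)\<bar>"
          by (metis abs_ge_self abs_mult)
        also have "\<dots> \<le> \<bar>\<phi> t\<bar> * e"
          using close[OF t] by (intro mult_left_mono) auto
        finally show "\<phi> t * (\<phi> t - p (cos t)) \<le> \<bar>\<phi> t\<bar> * e" .
      qed (use t in \<open>auto intro: sin_ge_zero\<close>)
      finally show "(\<phi> t)\<^sup>2 * sin t - \<phi> t * p (cos t) * sin t \<le> e * (\<bar>\<phi> t\<bar> * sin t)"
        by (simp add: mult_ac)
    qed (auto intro!: int continuous_intros cont cp)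
    also have "\<dots> = e * L" by (simp add: L_def)
    finally show ?thesis .
  qed
  have "integral {0..pi} (\<lambda>t. (\<phi> t)\<^sup>2 * sin t) \<le> 0"
  proof (rule field_le_epsilon)
    fix e :: real assume e: "0 < e"
    \<comment> \<open>\<open>L\<close> may be 0, hence the denominator \<open>L + 1\<close>.\<close>
    have "e / (L + 1) * L \<le> e"
      using e L0 by (simp add: field_simps)
    then show "integral {0..pi} (\<lambda>t. (\<phi> t)\<^sup>2 * sin t) \<le> 0 + e"
      using le[of "e / (L + 1)"] e L0 by simp
  qed
  moreover have "0 \<le> integral {0..pi} (\<lambda>t. (\<phi> t)\<^sup>2 * sin t)"
    by (rule integral_nonneg)
      (auto intro!: int continuous_intros cont mult_nonneg_nonneg sin_ge_zero)
  ultimately have "integral {0..pi} (\<lambda>t. (\<phi> t)\<^sup>2 * sin t) = 0" by simp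
  then have "\<forall>t\<in>{0..pi}. (\<phi> t)\<^sup>2 * sin t = 0"
    by (subst (asm) integral_eq_0_iff)
      (auto intro!: continuous_intros cont mult_nonneg_nonneg sin_ge_zero)
  moreover have "sin t \<noteq> 0" using sin_gt_zero[OF t] by simp
  ultimately show ?thesis using t by auto
qed

lemma cos_moments_zero:
  fixes \<phi> :: "real \<Rightarrow> complex"
  assumes cont: "continuous_on {0..pi} \<phi>"
    and mom: "\<And>n. integral {0..pi} (\<lambda>t. \<phi> t * of_real (cos t) ^ n * of_real (sin t)) = 0"
    and t: "0 < t" "t < pi"
  shows "\<phi> t = 0"
proof (rule complex_eqI)
  have int: "(\<lambda>t. \<phi> t * of_real (cos t) ^ n * of_real (sin t)) integrable_on {0..pi}" for n
    by (intro integrable_continuous_interval continuous_intros cont)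
  have real: "\<phi> t * of_real (cos t) ^ n * of_real (sin t) = \<phi> t * of_real (cos t ^ n * sin t)"
    for n t by simp
  show "Re (\<phi> t) = Re 0"
    using real_cos_moments_zero[of "\<lambda>t. Re (\<phi> t)", OF _ _ t] integral_linear[OF int bounded_linear_Re] mom
    by (auto intro!: continuous_intros cont simp: comp_def real mult.assoc)
  show "Im (\<phi> t) = Im 0"
    using real_cos_moments_zero[of "\<lambda>t. Im (\<phi> t)", OF _ _ t] integral_linear[OF int bounded_linear_Im] mom
    by (auto intro!: continuous_intros cont simp: comp_def real mult.assoc)
qed

section \<open>Integrals depending holomorphically on a parameter\<close>

text \<open>Differentiation under the integral sign gives a real derivative whose antilinear
  coefficient is the integral of \<open>fzb\<close>, that is 0. What remains is multiplication by a
  complex number.\<close>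

lemma holomorphic_integral_dbar_zero:
  fixes f :: "complex \<Rightarrow> real \<Rightarrow> complex" and fz fzb :: "complex \<times> real \<Rightarrow> complex"
  assumes N: "open N"
    and der: "\<And>z t. z \<in> N \<Longrightarrow> t \<in> {a..b} \<Longrightarrow>
      ((\<lambda>z. f z t) has_derivative (\<lambda>\<zeta>. fz (z, t) * \<zeta> + fzb (z, t) * cnj \<zeta>)) (at z)"
    and cf: "\<And>z. z \<in> N \<Longrightarrow> continuous_on {a..b} (f z)"
    and cz: "continuous_on (N \<times> {a..b}) fz" and czb: "continuous_on (N \<times> {a..b}) fzb"
    and zero: "\<And>z. z \<in> N \<Longrightarrow> ((\<lambda>t. fzb (z, t)) has_integral 0) {a..b}"
  shows "(\<lambda>z. integral {a..b} (f z)) holomorphic_on N"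
  unfolding holomorphic_on_open[OF N]
proof (intro ballI)
  fix z0 assume z0: "z0 \<in> N"
  \<comment> \<open>The Leibniz rule is applied on a convex set, hence the ball.\<close>
  then obtain \<delta> where \<delta>: "0 < \<delta>" "ball z0 \<delta> \<subseteq> N"
    using N openE by blast
  let ?B = "ball z0 \<delta>"
  \<comment> \<open>The Leibniz rule asks for continuity of the derivative as a bounded linear
    map.\<close>
  define fx where "fx z t = blinfun_mult_right (fz (z, t)) +
      (blinfun_mult_right (fzb (z, t)) o\<^sub>L Blinfun cnj)" for z t
  have fx: "blinfun_apply (fx z t) = (\<lambda>\<zeta>. fz (z, t) * \<zeta> + fzb (z, t) * cnj \<zeta>)" for z t
    by (simp add: fun_eq_iff fx_def blinfun.add_left bounded_linear_Blinfun_apply bounded_linear_cnj)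
  have sub: "?B \<times> {a..b} \<subseteq> N \<times> {a..b}" using \<delta>(2) by blast
  have cfx: "continuous_on (N \<times> {a..b}) (\<lambda>(z, t). fx z t)"
    unfolding fx_def case_prod_beta
    by (auto intro!: continuous_intros cz czb
        bounded_linear.continuous_on[OF bounded_linear_blinfun_mult_right])
  have lr: "((\<lambda>z. integral {a..b} (f z)) has_derivative integral {a..b} (fx z0)) (at z0 within ?B)"
  proof (rule leibniz_rule[of ?B a b f fx z0, unfolded cbox_interval])
    fix z t assume zt: "z \<in> ?B" "t \<in> {a..b}"
    then show "((\<lambda>z. f z t) has_derivative blinfun_apply (fx z t)) (at z within ?B)"
      unfolding fx using der \<delta>(2) by (blast intro: has_derivative_at_withinI)
  next
    show "f z integrable_on {a..b}" if "z \<in> ?B" for z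
      using cf \<delta>(2) that by (blast intro: integrable_continuous_interval)
    show "continuous_on (?B \<times> {a..b}) (\<lambda>(z, t). fx z t)"
      by (rule continuous_on_subset[OF cfx sub])
  qed (use \<delta>(1) in auto)
  have slice: "continuous_on {a..b} (\<lambda>t. h (z0, t))"
    if "continuous_on (N \<times> {a..b}) h" for h :: "complex \<times> real \<Rightarrow> 'z::topological_space"
    by (rule continuous_on_compose2[OF that]) (use z0 in \<open>auto intro!: continuous_intros\<close>)
  have int: "fx z0 integrable_on {a..b}"
    using slice[OF cfx] by (auto intro: integrable_continuous_interval)
  have "blinfun_apply (integral {a..b} (fx z0)) \<zeta> = integral {a..b} (\<lambda>t. fx z0 t \<zeta>)" for \<zeta>
    using integral_linear[OF int bounded_linear_apply_blinfun, of \<zeta>] by (simp add: comp_def)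
  also have "integral {a..b} (\<lambda>t. fx z0 t \<zeta>) = integral {a..b} (\<lambda>t. fz (z0, t)) * \<zeta>" for \<zeta>
  proof -
    have "(\<lambda>t. fz (z0, t)) integrable_on {a..b}"
      using slice[OF cz] by (rule integrable_continuous_interval)
    then have "((\<lambda>t. fz (z0, t) * \<zeta> + fzb (z0, t) * cnj \<zeta>) has_integral
        integral {a..b} (\<lambda>t. fz (z0, t)) * \<zeta> + 0 * cnj \<zeta>) {a..b}"
      by (intro has_integral_add has_integral_mult_left zero z0 integrable_integral)
    then show ?thesis by (simp add: fx integral_unique)
  qed
  finally have "blinfun_apply (integral {a..b} (fx z0)) = (*) (integral {a..b} (\<lambda>t. fz (z0, t)))"
    by blast
  then show "\<exists>f'. ((\<lambda>z. integral {a..b} (f z)) has_field_derivative f') (at z0)"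
    using lr \<delta>(1) at_within_open[of z0 ?B] by (auto simp: has_field_derivative_def)
qed

text \<open>
  The function \<open>u = w + v z / w\<close> is holomorphic, and the integral below is \<open>\<oint> g u\<^sup>n du\<close> over a
  circle in a fibre of \<open>z\<close>. Its \<open>\<bar>z\<close>-derivative is the integral of the \<open>w\<close>-derivative of
  \<open>g u\<^sup>n v\<^sub>\<bar>z / w\<close>, hence zero.
\<close>

lemma fibre_integral_holomorphic:
  fixes g gz gzb gw :: "complex \<times> complex \<Rightarrow> complex" and v vz vzb :: "complex \<Rightarrow> complex"
  assumes N: "open N" and r: "0 < r" and NU: "N \<times> sphere 0 r \<subseteq> U"
    and v: "\<And>z. z \<in> N \<Longrightarrow> (v has_derivative (\<lambda>\<zeta>. vz z * \<zeta> + vzb z * cnj \<zeta>)) (at z)"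
    and cv: "continuous_on N vz" "continuous_on N vzb"
    and g: "\<And>p. p \<in> U \<Longrightarrow>
      (g has_derivative (\<lambda>(\<zeta>, \<eta>). gz p * \<zeta> + gzb p * cnj \<zeta> + gw p * \<eta>)) (at p)"
    and cg: "continuous_on U gz" "continuous_on U gzb" "continuous_on U gw"
    and dbar: "\<And>z w. (z, w) \<in> U \<Longrightarrow> z \<in> N \<Longrightarrow> gzb (z, w) * (w\<^sup>2 - v z) = gw (z, w) * (w * vzb z)"
  shows "(\<lambda>z. integral {-pi..pi} (\<lambda>t. g (z, r * cis t) * (r * cis t + v z / (r * cis t)) ^ n *
           (\<i> * (r * cis t - v z / (r * cis t))))) holomorphic_on N"
proof -
  define w where "w t = of_real r * cis t" for t
  define u where "u z t = w t + v z / w t" for z t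
  \<comment> \<open>This is the t-derivative of \<open>u z t\<close>, so \<open>m z t\<close> dt is
    du on the circle.\<close>
  define m where "m z t = \<i> * (w t - v z / w t)" for z t
  have w0: "w t \<noteq> 0" for t using r by (simp add: w_def)
  have wU: "(z, w t) \<in> U" if "z \<in> N" for z t
    using NU that r by (auto simp: w_def norm_mult)
  have cw: "continuous_on S w" for S
    unfolding w_def by (intro continuous_intros)
  have cw': "continuous_on S (\<lambda>x. w (h x))" if "continuous_on S h" for S and h :: "'z::topological_space \<Rightarrow> real"
    by (rule continuous_on_compose2[OF cw that]) auto
  have cv0: "continuous_on N v"
    using v by (meson continuous_at_imp_continuous_on has_derivative_continuous)
  have cg0: "continuous_on U g"
    using g by (meson continuous_at_imp_continuous_on has_derivative_continuous)
  let ?NI = "N \<times> {-pi..pi}"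
  have c1: "continuous_on ?NI (\<lambda>p. h (fst p))" if "continuous_on N h" for h :: "complex \<Rightarrow> complex"
    by (rule continuous_on_compose2[OF that]) (auto intro!: continuous_intros)
  have c2: "continuous_on ?NI (\<lambda>p. h (fst p, w (snd p)))"
    if "continuous_on U h" for h :: "complex \<times> complex \<Rightarrow> complex"
    by (rule continuous_on_compose2[OF that]) (auto intro!: continuous_intros cw' wU)
  have cu: "continuous_on ?NI (\<lambda>p. u (fst p) (snd p))" and cm: "continuous_on ?NI (\<lambda>p. m (fst p) (snd p))"
    unfolding u_def m_def by (auto intro!: continuous_intros c1 cw' cv0 simp: w0)
  note cont = continuous_intros c1[OF cv(1)] c1[OF cv(2)] c2[OF cg(1)] c2[OF cg(2)] c2[OF cg(3)]
    c2[OF cg0] cu cm cw'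
  define F where "F z t = g (z, w t) * u z t ^ n * m z t" for z t
  \<comment> \<open>The product rule for \<open>F\<close>, with \<open>G\<close> and
    \<open>V\<close> the derivatives of g and v: one formula for both Wirtinger derivatives. At n =
    0 the factor \<open>of_nat n\<close> kills the term with the truncated exponent.\<close>
  define L where "L = (\<lambda>(z, t) G V.
    G * u z t ^ n * m z t + g (z, w t) * (of_nat n * u z t ^ (n - 1) * (V / w t)) * m z t
      - g (z, w t) * u z t ^ n * (\<i> * V / w t))"
  have "(\<lambda>z. integral {-pi..pi} (F z)) holomorphic_on N"
  proof (rule holomorphic_integral_dbar_zero[OF N,
      where fz = "\<lambda>(z, t). L (z, t) (gz (z, w t)) (vz z)" and
        fzb = "\<lambda>(z, t). L (z, t) (gzb (z, w t)) (vzb z)"])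
    fix z t assume z: "z \<in> N"
    have gz: "((\<lambda>z. g (z, w t)) has_derivative (\<lambda>\<zeta>. gz (z, w t) * \<zeta> + gzb (z, w t) * cnj \<zeta>)) (at z)"
    proof -
      have "((\<lambda>z. (z, w t)) has_derivative (\<lambda>\<zeta>. (\<zeta>, 0))) (at z)"
        by (auto intro!: derivative_eq_intros)
      from has_derivative_compose[OF this g[OF wU[OF z]]] show ?thesis by simp
    qed
    have ud: "((\<lambda>z. u z t) has_derivative (\<lambda>\<zeta>. (vz z * \<zeta> + vzb z * cnj \<zeta>) / w t)) (at z)"
      unfolding u_def by (auto intro!: derivative_eq_intros v z simp: w0)
    have md: "((\<lambda>z. m z t) has_derivative (\<lambda>\<zeta>. - \<i> * ((vz z * \<zeta> + vzb z * cnj \<zeta>) / w t))) (at z)"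
      unfolding m_def by (auto intro!: derivative_eq_intros v z simp: w0)
    show "((\<lambda>z. F z t) has_derivative (\<lambda>\<zeta>. (case (z, t) of (z, t) \<Rightarrow> L (z, t) (gz (z, w t)) (vz z)) * \<zeta>
        + (case (z, t) of (z, t) \<Rightarrow> L (z, t) (gzb (z, w t)) (vzb z)) * cnj \<zeta>)) (at z)"
      unfolding F_def L_def
      by (rule derivative_eq_intros gz ud md refl)+
        (simp add: fun_eq_iff field_simps w0)
  next
    fix z assume z: "z \<in> N"
    show "continuous_on {-pi..pi} (F z)"
      unfolding F_def u_def m_def
      by (auto intro!: continuous_intros continuous_on_compose2[OF cg0] cw wU z simp: w0)
    define P where "P t = g (z, w t) * u z t ^ n * (vzb z / w t)" for t
    have wd: "(w has_derivative (\<lambda>h. of_real h * (\<i> * w t))) (at t)" for t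
      unfolding w_def by (auto intro!: derivative_eq_intros simp: fun_eq_iff scaleR_conv_of_real)
    have "(P has_vector_derivative L (z, t) (gzb (z, w t)) (vzb z)) (at t)" for t
    proof -
      have gt: "((\<lambda>t. g (z, w t)) has_derivative (\<lambda>h. gw (z, w t) * (of_real h * (\<i> * w t)))) (at t)"
      proof -
        have "((\<lambda>t. (z, w t)) has_derivative (\<lambda>h. (0, of_real h * (\<i> * w t)))) (at t)"
          by (auto intro!: derivative_eq_intros wd)
        from has_derivative_compose[OF this g[OF wU[OF z]]] show ?thesis by simp
      qed
      have ut: "((\<lambda>t. u z t) has_derivative (\<lambda>h. of_real h * m z t)) (at t)"
        unfolding u_def m_def
        by (rule derivative_eq_intros wd refl w0)+ (simp add: fun_eq_iff field_simps w0)
      \<comment> \<open>The derivative of \<open>P\<close> and \<open>L\<close> differ in one term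
        only, the one with \<open>gw\<close> against the one with \<open>gzb\<close>. The equation
        \<open>dbar\<close>, divided by w, equates the two.\<close>
      have key: "gzb (z, w t) * m z t = \<i> * gw (z, w t) * vzb z"
      proof -
        have "m z t = \<i> * ((w t)\<^sup>2 - v z) / w t"
          using w0[of t] by (simp add: m_def field_simps power2_eq_square)
        then have "gzb (z, w t) * m z t = \<i> * (gzb (z, w t) * ((w t)\<^sup>2 - v z)) / w t"
          by simp
        also have "\<dots> = \<i> * gw (z, w t) * vzb z"
          using w0[of t] by (simp add: dbar[OF wU[OF z] z])
        finally show ?thesis .
      qed
      have "(P has_derivative (\<lambda>h. of_real h * (\<i> * gw (z, w t) * vzb z * u z t ^ n
          + g (z, w t) * (of_nat n * u z t ^ (n - 1) * (vzb z / w t)) * m z t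
          - g (z, w t) * u z t ^ n * (\<i> * vzb z / w t)))) (at t)"
        unfolding P_def
        by (rule derivative_eq_intros gt ut wd refl w0)+ (simp add: fun_eq_iff field_simps w0)
      moreover have eq: "gzb (z, w t) * u z t ^ n * m z t = \<i> * gw (z, w t) * vzb z * u z t ^ n"
        using arg_cong[OF key, of "\<lambda>x. x * u z t ^ n"] by (simp only: mult_ac)
      ultimately show ?thesis
        by (simp only: L_def has_vector_derivative_def prod.case scaleR_conv_of_real eq)
    qed
    then have "((\<lambda>t. L (z, t) (gzb (z, w t)) (vzb z)) has_integral (P pi - P (-pi))) {-pi..pi}"
      by (intro fundamental_theorem_of_calculus) (auto intro: has_vector_derivative_at_within)
    \<comment> \<open>\<open>P\<close> depends on t only through \<open>cis t\<close>, so the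
      boundary terms cancel.\<close>
    moreover have "P pi = P (-pi)"
      by (simp add: P_def u_def w_def cis.code)
    ultimately show "((\<lambda>t. case (z, t) of (z, t) \<Rightarrow> L (z, t) (gzb (z, w t)) (vzb z)) has_integral 0) {-pi..pi}"
      by simp
  qed (auto simp: L_def case_prod_beta intro!: cont simp: w0)
  then show ?thesis unfolding F_def[abs_def] u_def m_def w_def .
qed

section \<open>The function v and the coefficient of \<open>J\<close>\<close>

text \<open>This is v, with \<open>branch_z\<close> and \<open>branch_zb\<close> its Wirtinger
  derivatives. The z- and zbar-derivatives of |z|^2 are \<open>cnj z\<close> and z, whence the
  exponent k + 1 in the latter.\<close>

definition branch :: "(real \<Rightarrow> real) \<Rightarrow> nat \<Rightarrow> complex \<Rightarrow> complex" where
  "branch lam k z = z ^ k * of_real (lam ((cmod z)\<^sup>2))"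

definition branch_z :: "(real \<Rightarrow> real) \<Rightarrow> nat \<Rightarrow> complex \<Rightarrow> complex" where
  "branch_z lam k z = of_nat k * z ^ (k - 1) * of_real (lam ((cmod z)\<^sup>2)) +
     z ^ k * cnj z * of_real (deriv lam ((cmod z)\<^sup>2))"

definition branch_zb :: "(real \<Rightarrow> real) \<Rightarrow> nat \<Rightarrow> complex \<Rightarrow> complex" where
  "branch_zb lam k z = z ^ (k + 1) * of_real (deriv lam ((cmod z)\<^sup>2))"

lemma cutoff_has_derivative:
  assumes "cutoff lam"
  shows "(lam has_real_derivative deriv lam t) (at t)"
  using assms unfolding cutoff_def smooth_real_def
  by (metis DERIV_deriv_iff_field_differentiable funpow_0)

lemma cutoff_continuous:
  assumes "cutoff lam"
  shows "continuous_on S lam" "continuous_on S (deriv lam)"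
proof -
  have "(deriv ^^ n) lam field_differentiable (at t)" for n t
    using assms by (auto simp: cutoff_def smooth_real_def)
  from this[of 0] this[of 1] show "continuous_on S lam" "continuous_on S (deriv lam)"
    by (auto intro!: continuous_at_imp_continuous_on field_differentiable_imp_continuous_at)
qed

text \<open>On the open rays \<open>lam\<close> is constant. Continuity of its derivative adds the
  endpoints 1/9 and 4/9, the squares of the radii 1/3 and 2/3 at which \<open>a_coeff\<close> is set
  to 0.\<close>

lemma cutoff_deriv_zero:
  assumes lam: "cutoff lam" and t: "t \<le> 1/9 \<or> 4/9 \<le> t"
  shows "deriv lam t = 0"
proof -
  have const: "deriv lam s = 0" if "open S" "s \<in> S" "\<And>x. x \<in> S \<Longrightarrow> lam x = c" for S s c
    using has_field_derivative_transform_within_open[OF DERIV_const[of c] that(1,2)] that(3)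
    by (metis DERIV_imp_deriv)
  have "deriv lam s = 0" if "s \<in> {..<1/9} \<union> {4/9<..}" for s
    using that lam const[of "{..<1/9}" s 0] const[of "{4/9<..}" s 1] by (auto simp: cutoff_def)
  then have "{..<1/9} \<union> {4/9<..} \<subseteq> {s. deriv lam s = 0}" by blast
  moreover have "closed {s. deriv lam s = 0}"
    by (intro closed_Collect_eq cutoff_continuous(2) lam continuous_intros)
  ultimately have "closure ({..<1/9} \<union> {4/9<..}) \<subseteq> {s. deriv lam s = 0}"
    by (rule closure_minimal)
  then show ?thesis using t by (auto simp: closure_Un)
qed

lemma branch_has_derivative:
  assumes "cutoff lam"
  shows "(branch lam k has_derivative (\<lambda>\<zeta>. branch_z lam k z * \<zeta> + branch_zb lam k z * cnj \<zeta>)) (at z)"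
proof -
  have sq: "((\<lambda>z. (cmod z)\<^sup>2) has_derivative (\<lambda>\<zeta>. 2 * (z \<bullet> \<zeta>))) (at z)"
    unfolding power2_norm_eq_inner by (auto intro!: derivative_eq_intros simp: inner_commute)
  have "(lam has_derivative (*) (deriv lam ((cmod z)\<^sup>2))) (at ((cmod z)\<^sup>2))"
    using cutoff_has_derivative[OF assms] by (simp add: has_field_derivative_def)
  from has_derivative_compose[OF sq this]
  have l: "((\<lambda>z. lam ((cmod z)\<^sup>2)) has_derivative (\<lambda>\<zeta>. deriv lam ((cmod z)\<^sup>2) * (2 * (z \<bullet> \<zeta>)))) (at z)" .
  \<comment> \<open>Splits the real inner product into its linear and antilinear parts in
    \<zeta>.\<close>
  have inner: "of_real (z \<bullet> \<zeta>) = (z * cnj \<zeta> + cnj z * \<zeta>) / 2" for \<zeta>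
    by (simp add: complex_eq_iff inner_complex_def)
  show ?thesis
    unfolding branch_def
    by (rule derivative_eq_intros l refl)+
      (simp add: fun_eq_iff branch_z_def branch_zb_def field_simps inner)
qed

lemma branch_derivatives_continuous:
  assumes "cutoff lam"
  shows "continuous_on S (branch_z lam k)" "continuous_on S (branch_zb lam k)"
  unfolding branch_z_def branch_zb_def
  by (intro continuous_intros continuous_on_compose2[OF cutoff_continuous(1)[OF assms, of UNIV]]
      continuous_on_compose2[OF cutoff_continuous(2)[OF assms, of UNIV]] subset_UNIV)+

text \<open>For u = w + v/w this is the equation u_zbar = a u_w multiplied by w^2, so u is
  holomorphic for \<open>J\<close>. Inside the annulus the denominator is nonzero on
  \<open>M_set\<close>; outside it both sides vanish.\<close>

lemma a_coeff_branch:
  assumes lam: "cutoff lam" and M: "(z, w) \<in> M_set lam k"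
  shows "a_coeff lam k (z, w) * (w\<^sup>2 - branch lam k z) = w * branch_zb lam k z"
proof (cases "1/3 < cmod z \<and> cmod z < 2/3")
  case True
  then have "w\<^sup>2 \<noteq> branch lam k z" using M by (auto simp: M_set_def branch_def)
  then show ?thesis using True by (simp add: a_coeff_def branch_def branch_zb_def)
next
  case False
  then have "(cmod z)\<^sup>2 \<le> (1/3)\<^sup>2 \<or> (2/3)\<^sup>2 \<le> (cmod z)\<^sup>2"
    by (intro disj_forward[OF _ power_mono power_mono]) auto
  then have "deriv lam ((cmod z)\<^sup>2) = 0"
    by (intro cutoff_deriv_zero[OF lam]) (simp add: power2_eq_square)
  then show ?thesis using False by (simp add: a_coeff_def branch_zb_def)
qed

section \<open>The fold point and the symmetry of holomorphic functions\<close>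

text \<open>These bounds place the fold point c on the segment of the figure but beyond radius 2/3,
  where \<open>lam\<close> is 1 and so v(c) = c^k = r^2. A root at most 2/3 would force r^2 \<le>
  2/3, against r > 9/10.\<close>

lemma root_square_bounds:
  assumes r: "9/10 < r" "r < 1" and k: "1 \<le> k"
  shows "2/3 < root k (r\<^sup>2)" "root k (r\<^sup>2) \<le> 1" "root k (r\<^sup>2) ^ k = r\<^sup>2"
proof -
  have r2: "0 \<le> r\<^sup>2" "r\<^sup>2 \<le> 1" using r by (auto simp: power_le_one)
  show eq: "root k (r\<^sup>2) ^ k = r\<^sup>2" using k r2 by (simp add: real_root_pow_pos2)
  show "root k (r\<^sup>2) \<le> 1" using k r2 by simp
  show "2/3 < root k (r\<^sup>2)"
  proof (rule ccontr)
    assume "\<not> ?thesis"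
    then have "r\<^sup>2 \<le> (2/3) ^ k"
      using power_mono[of "root k (r\<^sup>2)" "2/3" k] real_root_ge_zero[OF r2(1), of k] by (simp add: eq)
    also have "\<dots> \<le> 2/3" using power_decreasing[OF k, of "2/3::real"] by simp
    finally have "r\<^sup>2 \<le> 2/3" .
    moreover have "(9/10)\<^sup>2 \<le> r\<^sup>2" using r by (intro power_mono) auto
    ultimately show False by (simp add: power2_eq_square)
  qed
qed

text \<open>Applied to the parameters z whose circle, or whose whole closed disc, lies in
  \<open>U\<close>.\<close>

lemma open_fibres:
  fixes K :: "'b::metric_space set" and U :: "('a::metric_space \<times> 'b) set"
  assumes "compact K" "open U"
  shows "open {z. {z} \<times> K \<subseteq> U}"
proof (subst open_subopen, clarify)
  fix z assume "{z} \<times> K \<subseteq> U"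
  then obtain V where "z \<in> V" "open V" "V \<times> K \<subseteq> U"
    using Elementary_Topology.tube_lemma[OF assms] by blast
  then show "\<exists>T. open T \<and> z \<in> T \<and> T \<subseteq> {z. {z} \<times> K \<subseteq> U}"
    by (intro exI[of _ V]) auto
qed

text \<open>At z = c the function u maps r cis t to 2 r cos t; the two points are the pair t = pi/2
  and t = -pi/2 that this fold identifies.\<close>

lemma J_holomorphic_circle_symmetric:
  assumes lam: "cutoff lam" and k: "1 \<le> k" and \<epsilon>: "0 < \<epsilon>" "\<epsilon> < 1/10"
    and U: "open U" "U \<subseteq> M_set lam k" "hartogs_f \<epsilon> ` hartogs_H \<subseteq> U"
    and g: "holo_on (J_forms lam k) forms_C U g"
  defines "r \<equiv> 1 - \<epsilon>"
  defines "c \<equiv> root k (r\<^sup>2)"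
  shows "g (of_real c, of_real r * \<i>) = g (of_real c, - (of_real r * \<i>))"
proof -
  have r: "9/10 < r" "r < 1" "0 < r" using \<epsilon> by (auto simp: r_def)
  note c = root_square_bounds[OF r(1,2) k, folded c_def]
  have H: "(x, of_real r * \<eta>) \<in> U" if "(x, \<eta>) \<in> hartogs_H" for x \<eta>
  proof -
    have "hartogs_f \<epsilon> (x, \<eta>) \<in> U" using that U(3) by blast
    then show ?thesis by (simp add: hartogs_f_def r_def)
  qed
  have disc: "(0, w) \<in> U" if "cmod w \<le> r" for w
    using H[of 0 "w / of_real r"] that r by (simp add: hartogs_H_def norm_divide)
  have circle: "(of_real x, w) \<in> U" if "x \<in> {-1..1}" "cmod w = r" for x w
    using H[of "of_real x" "w / of_real r"] that r by (simp add: hartogs_H_def norm_divide)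
  define W0 where "W0 = {z. {z} \<times> sphere 0 r \<subseteq> U}"
  have opO: "open W0" unfolding W0_def by (rule open_fibres[OF compact_sphere U(1)])
  let ?seg = "complex_of_real ` {0..1}"
  have seg: "?seg \<subseteq> W0" by (auto simp: W0_def intro!: circle)
  have conseg: "connected ?seg"
    by (intro connected_continuous_image continuous_intros) auto
  \<comment> \<open>The identity theorem needs a connected domain; this component contains the whole
    segment from 0 to 1, hence also c.\<close>
  define N where "N = connected_component_set W0 0"
  have N: "open N" "connected N" "N \<times> sphere 0 r \<subseteq> U"
    using open_connected_component[OF opO] connected_component_subset[of W0 0]
    by (auto simp: N_def W0_def)
  have segN: "?seg \<subseteq> N"
    unfolding N_def by (rule connected_component_maximal[OF _ conseg seg]) auto
  obtain gz gzb gw where W: "continuous_on U gz" "continuous_on U gzb" "continuous_on U gw"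
    "\<And>p. p \<in> U \<Longrightarrow> (g has_derivative (\<lambda>(\<zeta>, \<eta>). gz p * \<zeta> + gzb p * cnj \<zeta> + gw p * \<eta>)) (at p)"
    "\<And>p. p \<in> U \<Longrightarrow> gzb p = gw p * a_coeff lam k p"
    using J_holomorphic_wirtinger[OF g] by blast
  define f where "f n z t = g (z, r * cis t) * (r * cis t + branch lam k z / (r * cis t)) ^ n *
      (\<i> * (r * cis t - branch lam k z / (r * cis t)))" for n z t
  have hol: "(\<lambda>z. integral {-pi..pi} (f n z)) holomorphic_on N" for n
    unfolding f_def
  proof (rule fibre_integral_holomorphic[OF N(1) r(3) N(3) branch_has_derivative[OF lam]
        branch_derivatives_continuous[OF lam] W(4,1,2,3)])
    show "gzb (z, w) * (w\<^sup>2 - branch lam k z) = gw (z, w) * (w * branch_zb lam k z)"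
      if "(z, w) \<in> U" for z w
      using W(5)[OF that] a_coeff_branch[OF lam] that U(2) by (metis mult.assoc subsetD)
  qed
  \<comment> \<open>Here |z|^2 < 1/9, so v = 0 and u = w: the moment is the integral of g w^n dw
    around a circle whose full disc lies in \<open>U\<close>.\<close>
  have near0: "integral {-pi..pi} (f n z) = 0"
    if z: "cmod z < 1/3" "{z} \<times> cball 0 r \<subseteq> U" for n z
  proof -
    have "(cmod z)\<^sup>2 < (1/3)\<^sup>2" using z by (intro power_strict_mono) auto
    then have v0: "branch lam k z = 0"
      using lam by (simp add: branch_def cutoff_def power2_eq_square)
    have "(\<lambda>w. g (z, w) * w ^ n) holomorphic_on cball 0 r"
    proof (intro holomorphic_intros)
      \<comment> \<open>No antilinear term in \<eta> occurs in the differential of g, so g is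
        holomorphic along each fibre.\<close>
      have "((\<lambda>w. g (z, w)) has_field_derivative gw (z, w)) (at w)" if "w \<in> cball 0 r" for w
      proof -
        have "(z, w) \<in> U" using that z(2) by auto
        have "((\<lambda>w. (z, w)) has_derivative (\<lambda>h. (0, h))) (at w)"
          by (auto intro!: derivative_eq_intros)
        from has_derivative_compose[OF this W(4)[OF \<open>(z, w) \<in> U\<close>]] show ?thesis
          by (simp add: has_field_derivative_def)
      qed
      then show "(\<lambda>w. g (z, w)) holomorphic_on cball 0 r"
        by (meson holomorphic_onI field_differentiable_at_within field_differentiable_def)
    qed
    \<comment> \<open>Makes the arc from -pi to pi a closed path.\<close>
    moreover have "cis (- pi) = - 1" by (simp add: complex_eq_iff)
    ultimately have "((\<lambda>w. g (z, w) * w ^ n) has_contour_integral 0) (part_circlepath 0 r (-pi) pi)"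
      using path_image_part_circlepath_subset'[of r 0 "-pi" pi] r
      by (intro Cauchy_theorem_convex_simple[of _ "cball 0 r"])
        (auto simp: pathstart_part_circlepath pathfinish_part_circlepath exp_eq_polar dist_norm
          simp flip: cis_conv_exp)
    then have "((\<lambda>t. g (z, r * cis t) * (r * cis t) ^ n * r * \<i> * cis t) has_integral 0) {-pi..pi}"
      by (subst (asm) has_contour_integral_part_circlepath_iff) auto
    then have "(f n z has_integral 0) {-pi..pi}"
      unfolding f_def v0 by (simp add: mult_ac)
    then show ?thesis by (rule integral_unique)
  qed
  define B where "B = N \<inter> ball 0 (1/3) \<inter> {z. {z} \<times> cball 0 r \<subseteq> U}"
  have opB: "open B"
    unfolding B_def by (intro open_Int N open_ball open_fibres[OF compact_cball U(1)])
  have "0 \<in> B"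
    using segN by (force simp: B_def intro: disc)
  then have B: "B \<noteq> {}" "B \<subseteq> N" by (auto simp: B_def)
  have near0B: "integral {-pi..pi} (f n z) = 0" if "z \<in> B" for n z
    by (rule near0) (use that in \<open>simp_all add: B_def\<close>)
  have cN: "of_real c \<in> N" using segN c by auto
  have zero: "integral {-pi..pi} (f n (of_real c)) = 0" for n
    by (rule analytic_continuation_open[OF opB N(1) B(1) N(2) B(2) hol[of n] _ near0B cN])
      (rule holomorphic_on_const)
  have vc: "branch lam k (of_real c) = (of_real r)\<^sup>2"
  proof -
    have "(2/3)\<^sup>2 < c\<^sup>2" using c by (intro power_strict_mono) auto
    then have "lam (c\<^sup>2) = 1" using lam by (simp add: cutoff_def power2_eq_square)
    then show ?thesis
      using c(3) by (simp add: branch_def flip: of_real_power)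
  qed
  define G where "G t = g (of_real c, of_real r * cis t)" for t
  have contG: "continuous_on S G" for S
  proof -
    have cg: "continuous_on U g"
      using W(4) by (meson continuous_at_imp_continuous_on has_derivative_continuous)
    have "(of_real c, of_real r * cis t) \<in> U" for t
      using c r by (intro circle) (auto simp: norm_mult)
    then show ?thesis
      unfolding G_def by (intro continuous_on_compose2[OF cg] continuous_intros) auto
  qed
  \<comment> \<open>On |w| = r the quotient r^2/w is the conjugate of w, so u = 2 r cos t and du =
    -2 r sin t dt.\<close>
  have fc: "f n (of_real c) t =
      - ((2 * of_real r) ^ Suc n) * (G t * of_real (cos t) ^ n * of_real (sin t))" for n t
  proof -
    have q: "branch lam k (of_real c) / (r * cis t) = of_real r * cis (- t)"
    proof -
      have "of_real r * cis (- t) * (r * cis t) = (of_real r)\<^sup>2 * (cis t * cis (- t))"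
        by (simp only: power2_eq_square mult_ac)
      then show ?thesis
        using r by (simp add: vc cis_mult nonzero_divide_eq_eq)
    qed
    have "of_real r * cis t + of_real r * cis (- t) = 2 * of_real r * of_real (cos t)"
      "\<i> * (of_real r * cis t - of_real r * cis (- t)) = - (2 * of_real r * of_real (sin t))"
      by (auto simp: complex_eq_iff)
    then show ?thesis
      unfolding f_def q G_def by (simp add: power_mult_distrib)
  qed
  have mom: "integral {-pi..pi} (\<lambda>t. G t * of_real (cos t) ^ n * of_real (sin t)) = 0" for n
  proof -
    have "f n (of_real c) = (\<lambda>t. - ((2 * of_real r) ^ Suc n) *
        (G t * of_real (cos t) ^ n * of_real (sin t)))"
      by (rule ext) (rule fc)
    then show ?thesis using zero[of n] r by simp
  qed
  \<comment> \<open>As cos is even and sin is odd, folding the moments from [-pi, pi] onto [0, pi]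
    leaves the moments of this difference.\<close>
  define \<phi> where "\<phi> t = G t - G (- t)" for t
  have "\<phi> (pi/2) = 0"
  proof (rule cos_moments_zero)
    show "continuous_on {0..pi} \<phi>"
      unfolding \<phi>_def by (intro continuous_intros contG continuous_on_compose2[OF contG[of UNIV]]) auto
    fix n
    define h where "h t = G t * of_real (cos t) ^ n * of_real (sin t)" for t
    have int: "h integrable_on {a..b}" for a b
      unfolding h_def by (intro integrable_continuous_interval continuous_intros contG)
    have "(\<lambda>t. h (- t)) integrable_on {- 0..- (- pi)}"
      by (subst Henstock_Kurzweil_Integration.integrable_reflect_real) (rule int)
    then have int': "(\<lambda>t. h (- t)) integrable_on {0..pi}"
      by (simp only: minus_zero minus_minus)
    have "integral {0..pi} (\<lambda>t. \<phi> t * of_real (cos t) ^ n * of_real (sin t)) =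
        integral {0..pi} (\<lambda>t. h t + h (- t))"
      by (simp add: \<phi>_def h_def algebra_simps)
    also have "\<dots> = integral {0..pi} h + integral {0..pi} (\<lambda>t. h (- t))"
      by (rule integral_add[OF int int'])
    also have "integral {0..pi} (\<lambda>t. h (- t)) = integral {-pi..0} h"
      using Henstock_Kurzweil_Integration.integral_reflect_real[where a = "-pi" and b = 0 and f = h]
      by (simp only: minus_zero minus_minus)
    also have "integral {0..pi} h + integral {-pi..0} h = integral {-pi..pi} h"
      using Henstock_Kurzweil_Integration.integral_combine[of "-pi" 0 pi h] int by (simp add: add.commute)
    also have "\<dots> = 0"
      unfolding h_def[abs_def] by (rule mom)
    finally show "integral {0..pi} (\<lambda>t. \<phi> t * of_real (cos t) ^ n * of_real (sin t)) = 0" .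
  qed auto
  moreover have "cis (- (pi/2)) = - \<i>" by (simp add: complex_eq_iff)
  ultimately show ?thesis by (simp add: \<phi>_def G_def)
qed

section \<open>Contradiction with separation of points\<close>

theorem lemma3:
  fixes lam :: "real \<Rightarrow> real" and k :: nat and \<epsilon> :: real
    and X :: "'a topology" and A :: "('a, 'n::finite) atlas"
  assumes "cutoff lam"
    and "1 \<le> k"
    and "0 < \<epsilon>" and "\<epsilon> < 1/10"
    and "stein_manifold X A"
  shows "\<not> (\<exists>U. openin (top_of_set (M_set lam k)) U \<and>
                hartogs_f \<epsilon> ` hartogs_H \<subseteq> U \<and>
                biholomorphic_to_open_subset (J_forms lam k) U X A)"
proof
  assume "\<exists>U. openin (top_of_set (M_set lam k)) U \<and>
                hartogs_f \<epsilon> ` hartogs_H \<subseteq> U \<and>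
                biholomorphic_to_open_subset (J_forms lam k) U X A"
  then obtain U V F G where U: "openin (top_of_set (M_set lam k)) U"
    "hartogs_f \<epsilon> ` hartogs_H \<subseteq> U" and bih: "biholomorphism (J_forms lam k) U X A V F G"
    unfolding biholomorphic_to_open_subset_def by blast
  have opU: "open U" "U \<subseteq> M_set lam k"
    using U(1) open_M_set[OF assms(1)] by (auto simp: openin_open_eq)
  define c where "c = root k ((1 - \<epsilon>)\<^sup>2)"
  \<comment> \<open>\<open>p 1\<close> and \<open>p (-1)\<close> are the two points at which every
    holomorphic function on \<open>U\<close> agrees.\<close>
  define p where "p s = (complex_of_real c, of_real (1 - \<epsilon>) * (s * \<i>))" for s
  have c: "0 \<le> c" "c \<le> 1"
    using root_square_bounds[of "1 - \<epsilon>" k] assms by (auto simp: c_def)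
  have pU: "p s \<in> U" if "cmod s = 1" for s
  proof -
    have "(complex_of_real c, s * \<i>) \<in> hartogs_H"
      using c that by (auto simp: hartogs_H_def norm_mult)
    then have "hartogs_f \<epsilon> (complex_of_real c, s * \<i>) \<in> U" using U(2) by blast
    then show ?thesis by (simp add: hartogs_f_def p_def)
  qed
  have hm: "homeomorphic_maps (top_of_set U) (subtopology X V) F G"
    using bih by (simp add: biholomorphism_def)
  have FX: "F q \<in> topspace X" and GF: "G (F q) = q" if "q \<in> U" for q
    using hm that continuous_map_image_subset_topspace[of "top_of_set U" "subtopology X V" F]
    by (auto simp: homeomorphic_maps_def)
  have "p 1 \<noteq> p (-1)" using assms(4) by (simp add: p_def)
  \<comment> \<open>\<open>G\<close> inverts \<open>F\<close> on \<open>U\<close>, so the images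
    stay distinct and a holomorphic function on the Stein manifold separates them.\<close>
  then have "F (p 1) \<noteq> F (p (-1))" using GF pU by (metis norm_minus_cancel norm_one)
  then obtain h where h: "h \<in> holo_functions A" "h (F (p 1)) \<noteq> h (F (p (-1)))"
    using assms(5) FX pU unfolding stein_manifold_def by (metis norm_minus_cancel norm_one)
  have holo: "holo_on (J_forms lam k) forms_C U (h \<circ> F)"
    using holo_functions_comp_biholomorphism[OF h(1) _ opU(1) bih] assms(5)
    by (simp add: stein_manifold_def)
  have "(h \<circ> F) (p 1) = (h \<circ> F) (p (-1))"
    using J_holomorphic_circle_symmetric[OF assms(1-4) opU U(2) holo] by (simp add: p_def c_def)
  then show False using h(2) by simp
qed

end
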